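(* Let $L$ be a bounded distributive lattice with Priestley space $(X,\pi,\leq)$, let $\mathcal{F}(L)$ be the set of filters of $L$ and $\mathcal{F}_-$ the set of closed upsets of $X$. Let $\Gamma:\mathcal{F}(L)\to\mathcal{F}_-$ be given by $\Gamma(F)=\bigcap\{a^+\mid a\in F\}$. Then $\Gamma$ is a homeomorphism from $\mathcal{F}(L)$ with the open upset topology to $\mathcal{F}_-^\Box$, a homeomorphism from $\mathcal{F}(L)$ with the open downset topology to $\mathcal{F}_-^{\Diamond}$, and a dual order-homeomorphism from the Priestley space $\mathcal{F}(L)$ to $\mathcal{F}_-^{\Diamond\Box}$. In particular, $\mathcal{F}_-^\Box$ and $\mathcal{F}_-^\Diamond$ are spectral spaces and $\mathcal{F}_-^{\Diamond\Box}$ is a Priestley space.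
   Context: A Priestley space is a compact space with a partial order $\le$ such that if $x\nleq y$ then there is a clopen upset containing $x$ and missing $y$. A space is coherent if its compact open sets form a basis that is a bounded sublattice of the lattice of open sets; a spectral space is a sober coherent space. A dual order-homeomorphism is a homeomorphism that is also an order-reversing isomorphism of posets. The Priestley space of $L$ is $P(L)=(X,\pi,\leq)$, where $X$ is the set of (proper) prime filters of $L$, $\leq$ is inclusion, and $\pi$ is generated by the sets $a^+=\{x\in X\mid a\in x\}$ and $a^-=\{x\in X\mid a\notin x\}$, $a\in L$. $\pi^-$ is the topology on $X$ consisting of the $\pi$-open downsets. $\mathcal{F}_-$ is the set of closed sets of $(X,\pi^-)$, i.e. the $\pi$-closed upsets (including $\varnothing$), ordered by inclusion. For $U$ open and $K$ compact in $(X,\pi^-)$ let $\Diamond_U=\{C\in\mathcal{F}_-\mid C\cap U\neq\varnothing\}$ and $\Box_K=\{C\in\mathcal{F}_-\mid C\cap K=\varnothing\}$. $\mathcal{F}_-^\Diamond$ is $\mathcal{F}_-$ with the hit topology, generated by all $\Diamond_U$; $\mathcal{F}_-^\Box$ is $\mathcal{F}_-$ with the miss topology, generated by all $\Box_K$; $\mathcal{F}_-^{\Diamond\Box}$ is $\mathcal{F}_-$ with the join of these two topologies (the hit-or-miss topology) and the inclusion order. Filters of $L$ are nonempty and may be improper. $\mathcal{F}(L)$ is ordered by inclusion and carries the topology generated by the sets $a^\uparrow=\{F\in\mathcal{F}(L)\mid a\in F\}$ and $a^\downarrow=\{F\in\mathcal{F}(L)\mid a\notin F\}$ for $a\in L$;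 this makes it a Priestley space. Its open upset (respectively open downset) topology consists of the open sets of this topology that are upsets (respectively downsets) under inclusion. *)

theory Defs
  imports "HOL-Analysis.Analysis"
begin

section \<open>Generated topologies\<close>

text \<open>
  The topology on \<open>S\<close> with subbasis \<open>\<B>\<close>. The carrier is inserted because the space of
  \<^const>\<open>topology_generated_by\<close> is only \<open>\<Union>\<B>\<close>, which need not be all of \<open>S\<close>: no hit
  set \<open>\<Diamond>\<^sub>U\<close> below contains the empty set.
\<close>

definition topology_on_by :: "'b set \<Rightarrow> 'b set set \<Rightarrow> 'b topology" where
  "topology_on_by S \<B> = topology_generated_by (insert S \<B>)"

lemma topspace_topology_on_by:
  "(\<And>B. B \<in> \<B> \<Longrightarrow> B \<subseteq> S) \<Longrightarrow> topspace (topology_on_by S \<B>) = S"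
  unfolding topology_on_by_def by (auto simp: topology_generated_by_topspace)

definition join_topology :: "'b topology \<Rightarrow> 'b topology \<Rightarrow> 'b topology" where
  "join_topology S T = topology_generated_by ({U. openin S U} \<union> {U. openin T U})"

lemma topspace_join_topology: "topspace (join_topology S T) = topspace S \<union> topspace T"
  unfolding join_topology_def topology_generated_by_topspace by (auto simp: topspace_def)


section \<open>Ordered topological spaces\<close>

definition upset_in :: "'b set \<Rightarrow> ('b \<Rightarrow> 'b \<Rightarrow> bool) \<Rightarrow> 'b set \<Rightarrow> bool" where
  "upset_in A le U \<longleftrightarrow> U \<subseteq> A \<and> (\<forall>x\<in>U. \<forall>y\<in>A. le x y \<longrightarrow> y \<in> U)"

definition downset_in :: "'b set \<Rightarrow> ('b \<Rightarrow> 'b \<Rightarrow> bool) \<Rightarrow> 'b set \<Rightarrow> bool" where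
  "downset_in A le U \<longleftrightarrow> U \<subseteq> A \<and> (\<forall>x\<in>U. \<forall>y\<in>A. le y x \<longrightarrow> y \<in> U)"

definition open_upset_topology :: "'b topology \<Rightarrow> ('b \<Rightarrow> 'b \<Rightarrow> bool) \<Rightarrow> 'b topology" where
  "open_upset_topology T le = topology (\<lambda>U. openin T U \<and> upset_in (topspace T) le U)"

definition open_downset_topology :: "'b topology \<Rightarrow> ('b \<Rightarrow> 'b \<Rightarrow> bool) \<Rightarrow> 'b topology" where
  "open_downset_topology T le = topology (\<lambda>U. openin T U \<and> downset_in (topspace T) le U)"

lemma openin_open_upset_topology:
  "openin (open_upset_topology T le) U \<longleftrightarrow> openin T U \<and> upset_in (topspace T) le U"
proof -
  have "istopology (\<lambda>U. openin T U \<and> upset_in (topspace T) le U)"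
    unfolding istopology_def upset_in_def by (safe; (blast | auto))
  then show ?thesis
    unfolding open_upset_topology_def by (simp add: topology_inverse')
qed

lemma openin_open_downset_topology:
  "openin (open_downset_topology T le) U \<longleftrightarrow> openin T U \<and> downset_in (topspace T) le U"
proof -
  have "istopology (\<lambda>U. openin T U \<and> downset_in (topspace T) le U)"
    unfolding istopology_def downset_in_def by (safe; (blast | auto))
  then show ?thesis
    unfolding open_downset_topology_def by (simp add: topology_inverse')
qed

lemma topspace_open_upset_topology: "topspace (open_upset_topology T le) = topspace T"
proof (rule subset_antisym)
  show "topspace (open_upset_topology T le) \<subseteq> topspace T"
    using openin_open_upset_topology openin_subset openin_topspace by metis
  have "openin (open_upset_topology T le) (topspace T)"
    by (simp add: openin_open_upset_topology upset_in_def)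
  then show "topspace T \<subseteq> topspace (open_upset_topology T le)"
    by (rule openin_subset)
qed

lemma topspace_open_downset_topology: "topspace (open_downset_topology T le) = topspace T"
proof (rule subset_antisym)
  show "topspace (open_downset_topology T le) \<subseteq> topspace T"
    using openin_open_downset_topology openin_subset openin_topspace by metis
  have "openin (open_downset_topology T le) (topspace T)"
    by (simp add: openin_open_downset_topology downset_in_def)
  then show "topspace T \<subseteq> topspace (open_downset_topology T le)"
    by (rule openin_subset)
qed

lemma closedin_open_downset_topology:
  "closedin (open_downset_topology T le) C \<longleftrightarrow> closedin T C \<and> upset_in (topspace T) le C"
  unfolding closedin_def topspace_open_downset_topology openin_open_downset_topology
    downset_in_def upset_in_def
  by blast

definition priestley_space :: "'b topology \<Rightarrow> ('b \<Rightarrow> 'b \<Rightarrow> bool) \<Rightarrow> bool" where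
  "priestley_space T le \<longleftrightarrow>
     compact_space T \<and>
     reflp_on (topspace T) le \<and> transp_on (topspace T) le \<and> antisymp_on (topspace T) le \<and>
     (\<forall>x\<in>topspace T. \<forall>y\<in>topspace T. \<not> le x y \<longrightarrow>
        (\<exists>U. openin T U \<and> closedin T U \<and> upset_in (topspace T) le U \<and> x \<in> U \<and> y \<notin> U))"

definition dual_order_homeomorphism ::
    "'b topology \<Rightarrow> ('b \<Rightarrow> 'b \<Rightarrow> bool) \<Rightarrow> 'c topology \<Rightarrow> ('c \<Rightarrow> 'c \<Rightarrow> bool) \<Rightarrow> ('b \<Rightarrow> 'c) \<Rightarrow> bool" where
  "dual_order_homeomorphism T le T' le' f \<longleftrightarrow>
     homeomorphic_map T T' f \<and>
     (\<forall>x\<in>topspace T. \<forall>y\<in>topspace T. le x y \<longleftrightarrow> le' (f y) (f x))"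


section \<open>Spectral spaces\<close>

definition coherent_space :: "'b topology \<Rightarrow> bool" where
  "coherent_space T \<longleftrightarrow>
     (let CO = {U. openin T U \<and> compactin T U} in
       (\<forall>U. openin T U \<longrightarrow> (\<exists>\<U>. \<U> \<subseteq> CO \<and> \<Union>\<U> = U)) \<and>
       {} \<in> CO \<and> topspace T \<in> CO \<and>
       (\<forall>U\<in>CO. \<forall>V\<in>CO. U \<inter> V \<in> CO \<and> U \<union> V \<in> CO))"

definition irreducible_closed :: "'b topology \<Rightarrow> 'b set \<Rightarrow> bool" where
  "irreducible_closed T C \<longleftrightarrow>
     closedin T C \<and> C \<noteq> {} \<and>
     (\<forall>A B. closedin T A \<and> closedin T B \<and> C = A \<union> B \<longrightarrow> C = A \<or> C = B)"

text \<open>Uniqueness of the generic point makes sober spaces \<open>T\<^sub>0\<close>.\<close>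

definition sober_space :: "'b topology \<Rightarrow> bool" where
  "sober_space T \<longleftrightarrow>
     (\<forall>C. irreducible_closed T C \<longrightarrow> (\<exists>!x. x \<in> topspace T \<and> T closure_of {x} = C))"

definition spectral_space :: "'b topology \<Rightarrow> bool" where
  "spectral_space T \<longleftrightarrow> sober_space T \<and> coherent_space T"


section \<open>Hit, miss and hit-or-miss topologies\<close>

definition closed_sets :: "'b topology \<Rightarrow> 'b set set" where
  "closed_sets Y = {C. closedin Y C}"

definition hit_set :: "'b topology \<Rightarrow> 'b set \<Rightarrow> 'b set set" where
  "hit_set Y U = {C \<in> closed_sets Y. C \<inter> U \<noteq> {}}"

definition miss_set :: "'b topology \<Rightarrow> 'b set \<Rightarrow> 'b set set" where
  "miss_set Y K = {C \<in> closed_sets Y. C \<inter> K = {}}"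

definition hit_topology :: "'b topology \<Rightarrow> 'b set topology" where
  "hit_topology Y = topology_on_by (closed_sets Y) {hit_set Y U | U. openin Y U}"

definition miss_topology :: "'b topology \<Rightarrow> 'b set topology" where
  "miss_topology Y = topology_on_by (closed_sets Y) {miss_set Y K | K. compactin Y K}"

definition hit_or_miss_topology :: "'b topology \<Rightarrow> 'b set topology" where
  "hit_or_miss_topology Y = join_topology (hit_topology Y) (miss_topology Y)"

lemma topspace_hit_topology: "topspace (hit_topology Y) = closed_sets Y"
  unfolding hit_topology_def by (rule topspace_topology_on_by) (auto simp: hit_set_def)

lemma topspace_miss_topology: "topspace (miss_topology Y) = closed_sets Y"
  unfolding miss_topology_def by (rule topspace_topology_on_by) (auto simp: miss_set_def)

lemma topspace_hit_or_miss_topology: "topspace (hit_or_miss_topology Y) = closed_sets Y"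
  by (simp add: hit_or_miss_topology_def topspace_join_topology topspace_hit_topology
      topspace_miss_topology)


section \<open>Filters and the Priestley space of a bounded distributive lattice\<close>

text \<open>
  The lattice \<open>L\<close> is the type \<open>'a\<close>; it may be trivial (\<open>bot = top\<close>). Filters may be improper.
\<close>

definition lattice_filter :: "'a::bounded_lattice set \<Rightarrow> bool" where
  "lattice_filter F \<longleftrightarrow>
     F \<noteq> {} \<and> (\<forall>a\<in>F. \<forall>b. a \<le> b \<longrightarrow> b \<in> F) \<and> (\<forall>a\<in>F. \<forall>b\<in>F. inf a b \<in> F)"

definition prime_filter :: "'a::bounded_lattice set \<Rightarrow> bool" where
  "prime_filter x \<longleftrightarrow>
     lattice_filter x \<and> x \<noteq> UNIV \<and> (\<forall>a b. sup a b \<in> x \<longrightarrow> a \<in> x \<or> b \<in> x)"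

definition filters :: "'a::bounded_lattice set set" where
  "filters = {F. lattice_filter F}"

definition prime_filters :: "'a::bounded_lattice set set" where
  "prime_filters = {x. prime_filter x}"

definition pf_plus :: "'a::bounded_lattice \<Rightarrow> 'a set set" where
  "pf_plus a = {x \<in> prime_filters. a \<in> x}"

definition pf_minus :: "'a::bounded_lattice \<Rightarrow> 'a set set" where
  "pf_minus a = {x \<in> prime_filters. a \<notin> x}"

definition pf_topology :: "'a::bounded_lattice set topology" where
  "pf_topology = topology_on_by prime_filters (range pf_plus \<union> range pf_minus)"

lemma topspace_pf_topology: "topspace pf_topology = prime_filters"
  unfolding pf_topology_def
  by (rule topspace_topology_on_by) (auto simp: pf_plus_def pf_minus_def)

definition pf_down_topology :: "'a::bounded_lattice set topology" where
  "pf_down_topology = open_downset_topology pf_topology (\<subseteq>)"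

lemma closed_sets_pf_down_topology:
  "closed_sets pf_down_topology =
     {C. closedin pf_topology C \<and> upset_in prime_filters (\<subseteq>) C}"
  by (simp add: closed_sets_def pf_down_topology_def closedin_open_downset_topology
      topspace_pf_topology)

definition filters_up :: "'a::bounded_lattice \<Rightarrow> 'a set set" where
  "filters_up a = {F \<in> filters. a \<in> F}"

definition filters_down :: "'a::bounded_lattice \<Rightarrow> 'a set set" where
  "filters_down a = {F \<in> filters. a \<notin> F}"

definition filters_topology :: "'a::bounded_lattice set topology" where
  "filters_topology = topology_on_by filters (range filters_up \<union> range filters_down)"

lemma topspace_filters_topology: "topspace filters_topology = filters"
  unfolding filters_topology_def
  by (rule topspace_topology_on_by) (auto simp: filters_up_def filters_down_def)

definition Gamma_map :: "'a::bounded_lattice set \<Rightarrow> 'a set set" where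
  "Gamma_map F = (\<Inter>a\<in>F. pf_plus a)"

end

theory Submission
  imports Defs
begin

text \<open>
  The inverse of \<open>\<Gamma>\<close> is \<open>C \<mapsto> {a. C \<subseteq> a\<^sup>+}\<close>: prime filter separation gives one identity,
  compactness of \<open>X\<close> the other. Under this bijection \<open>a \<in> F\<close> means that \<open>\<Gamma> F\<close> misses \<open>a\<^sup>-\<close>,
  which is both compact and open in \<open>\<pi>\<^sup>-\<close>. Hence the subbasic sets \<open>a\<^sup>\<up>\<close> and \<open>a\<^sup>\<down>\<close>
  correspond to a miss set and a hit set, and compactness reduces arbitrary miss and hit sets to
  these. The open upset and open downset topologies of any Priestley space are spectral; since
  \<open>\<Gamma>\<close> reverses the order, the miss (hit) topology is the open downset (upset) topology of the
  hit-or-miss topology.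
\<close>


section \<open>Priestley spaces\<close>

lemma compactin_coarser:
  assumes "compactin T K" "topspace T' = topspace T" "\<And>U. openin T' U \<Longrightarrow> openin T U"
  shows "compactin T' K"
  using assms unfolding compactin_def by metis

text \<open>Keeps track of the indices, not only of the sets of the cover: in the later uses they
  are lattice elements, and a finite set of them can be replaced by a join or a lower bound.\<close>

lemma compactin_indexed_subcover:
  assumes "compactin T K" "\<And>i. i \<in> I \<Longrightarrow> openin T (B i)" "K \<subseteq> (\<Union>i\<in>I. B i)"
  obtains J where "finite J" "J \<subseteq> I" "K \<subseteq> (\<Union>i\<in>J. B i)"
proof -
  have "\<forall>U\<in>B ` I. openin T U"
    using assms(2) by blast
  then obtain \<F> where F: "finite \<F>" "\<F> \<subseteq> B ` I" "K \<subseteq> \<Union>\<F>"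
    using assms(1,3) unfolding compactin_def by meson
  then obtain J where "J \<subseteq> I" "finite J" "\<F> = B ` J"
    using finite_subset_image by metis
  then show thesis
    using that F(3) by blast
qed

text \<open>Complementation exchanges clopen upsets and clopen downsets, so the separation axiom is
  self-dual. Results on open upsets thereby yield those on open downsets.\<close>

lemma priestley_space_dual:
  assumes "priestley_space T le"
  shows "priestley_space T (\<lambda>x y. le y x)"
proof -
  have "\<exists>U. openin T U \<and> closedin T U \<and> upset_in (topspace T) (\<lambda>x y. le y x) U \<and> x \<in> U \<and> y \<notin> U"
    if xy: "x \<in> topspace T" "y \<in> topspace T" "\<not> le y x" for x y
  proof -
    obtain U where U: "openin T U" "closedin T U" "upset_in (topspace T) le U" "y \<in> U" "x \<notin> U"
      using assms xy unfolding priestley_space_def by meson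
    have "upset_in (topspace T) (\<lambda>x y. le y x) (topspace T - U)"
      using U(3) unfolding upset_in_def by blast
    with U xy show ?thesis
      by (intro exI[of _ "topspace T - U"]) auto
  qed
  then show ?thesis
    using assms unfolding priestley_space_def reflp_on_def transp_on_def antisymp_on_def by meson
qed

lemma open_downset_topology_dual:
  "open_downset_topology T le = open_upset_topology T (\<lambda>x y. le y x)"
  by (simp add: topology_eq openin_open_downset_topology openin_open_upset_topology
      upset_in_def downset_in_def)

text \<open>No point of the complement of \<open>U\<close> lies above \<open>x\<close>, so each is
  excluded by a clopen upset containing \<open>x\<close>. The complement is compact, hence finitely
  many of these upsets exclude all of it, and their intersection is the required set.\<close>

lemma priestley_clopen_upset_basis:
  assumes P: "priestley_space T le"
    and U: "openin T U" "upset_in (topspace T) le U" and x: "x \<in> U"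
  obtains V where "openin T V" "closedin T V" "upset_in (topspace T) le V" "x \<in> V" "V \<subseteq> U"
proof -
  define \<V> where "\<V> = {V. openin T V \<and> closedin T V \<and> upset_in (topspace T) le V \<and> x \<in> V}"
  have xT: "x \<in> topspace T"
    using U x openin_subset by blast
  have "compactin T (topspace T - U)"
    using P U by (intro closedin_compact_space) (auto simp: priestley_space_def)
  moreover have "topspace T - U \<subseteq> (\<Union>V\<in>\<V>. topspace T - V)"
  proof
    fix y assume y: "y \<in> topspace T - U"
    then have "\<not> le x y"
      using U(2) x unfolding upset_in_def by blast
    then obtain V where "V \<in> \<V>" "y \<notin> V"
      using P xT y unfolding priestley_space_def \<V>_def by blast
    then show "y \<in> (\<Union>V\<in>\<V>. topspace T - V)"
      using y by blast
  qed
  moreover have "openin T (topspace T - V)" if "V \<in> \<V>" for V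
    using that by (auto simp: \<V>_def)
  ultimately obtain \<W> where W: "finite \<W>" "\<W> \<subseteq> \<V>" "topspace T - U \<subseteq> (\<Union>V\<in>\<W>. topspace T - V)"
    using compactin_indexed_subcover by metis
  \<comment> \<open>\<open>\<W>\<close> may be empty, namely when \<open>U\<close> is the whole
    space; the factor \<open>topspace T\<close> gives the right value in that case.\<close>
  define V where "V = topspace T \<inter> \<Inter>\<W>"
  have "openin T V"
    using W unfolding V_def \<V>_def
    by (intro openin_Int_Inter) auto
  moreover have "closedin T V"
  proof -
    have "V = \<Inter>(insert (topspace T) \<W>)"
      by (simp add: V_def)
    also have "closedin T \<dots>"
      using W by (intro closedin_Inter) (auto simp: \<V>_def)
    finally show ?thesis .
  qed
  moreover have "upset_in (topspace T) le V"
    using W unfolding V_def \<V>_def upset_in_def by blast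
  moreover have "x \<in> V"
    using W xT unfolding V_def \<V>_def by blast
  moreover have "V \<subseteq> U"
    using W openin_subset[OF U(1)] unfolding V_def by blast
  ultimately show thesis
    using that by blast
qed

section \<open>Spectrality of the open upset and open downset topologies\<close>

text \<open>Closed sets are compact in \<open>T\<close>, hence in the coarser topology. Conversely,
  a compact open set is covered by the clopen upsets inside it, so it is a finite union of them and
  therefore closed in \<open>T\<close>.\<close>

lemma compact_open_upset_iff_clopen:
  assumes P: "priestley_space T le"
  shows "openin (open_upset_topology T le) U \<and> compactin (open_upset_topology T le) U \<longleftrightarrow>
    openin T U \<and> closedin T U \<and> upset_in (topspace T) le U"
proof (intro iffI conjI)
  assume U: "openin T U \<and> closedin T U \<and> upset_in (topspace T) le U"
  then show "openin (open_upset_topology T le) U"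
    by (simp add: openin_open_upset_topology)
  have "compactin T U"
    using P U by (intro closedin_compact_space) (auto simp: priestley_space_def)
  then show "compactin (open_upset_topology T le) U"
    by (rule compactin_coarser)
      (auto simp: openin_open_upset_topology topspace_open_upset_topology)
next
  assume U: "openin (open_upset_topology T le) U \<and> compactin (open_upset_topology T le) U"
  then show oU: "openin T U" and up: "upset_in (topspace T) le U"
    by (simp_all add: openin_open_upset_topology)
  define \<V> where "\<V> = {V. openin T V \<and> closedin T V \<and> upset_in (topspace T) le V \<and> V \<subseteq> U}"
  have "U \<subseteq> \<Union>\<V>"
    using priestley_clopen_upset_basis[OF P oU up] unfolding \<V>_def by blast
  moreover have "\<forall>V\<in>\<V>. openin (open_upset_topology T le) V"
    by (simp add: \<V>_def openin_open_upset_topology)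
  ultimately obtain \<F> where F: "finite \<F>" "\<F> \<subseteq> \<V>" "U \<subseteq> \<Union>\<F>"
    using U unfolding compactin_def by meson
  then have "U = \<Union>\<F>"
    unfolding \<V>_def by blast
  moreover have "closedin T (\<Union>\<F>)"
    using F by (intro closedin_Union) (auto simp: \<V>_def)
  ultimately show "closedin T U"
    by simp
qed

lemma coherent_open_upset_topology:
  assumes P: "priestley_space T le"
  shows "coherent_space (open_upset_topology T le)"
proof -
  let ?CU = "{U. openin T U \<and> closedin T U \<and> upset_in (topspace T) le U}"
  have CU: "{U. openin (open_upset_topology T le) U \<and> compactin (open_upset_topology T le) U} = ?CU"
    by (simp only: compact_open_upset_iff_clopen[OF P])
  have "\<exists>\<U>. \<U> \<subseteq> ?CU \<and> \<Union>\<U> = U" if "openin (open_upset_topology T le) U" for U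
  proof -
    have "openin T U" "upset_in (topspace T) le U"
      using that by (simp_all add: openin_open_upset_topology)
    from priestley_clopen_upset_basis[OF P this] show ?thesis
      by (intro exI[of _ "{V \<in> ?CU. V \<subseteq> U}"]) blast
  qed
  moreover have "{} \<in> ?CU" "topspace T \<in> ?CU"
    by (simp_all add: upset_in_def)
  moreover have "U \<inter> V \<in> ?CU" "U \<union> V \<in> ?CU" if "U \<in> ?CU" "V \<in> ?CU" for U V
    using that unfolding upset_in_def by blast+
  ultimately show ?thesis
    unfolding coherent_space_def Let_def CU topspace_open_upset_topology
    by (intro conjI allI impI ballI)
qed

lemma closedin_open_upset_topology:
  "closedin (open_upset_topology T le) C \<longleftrightarrow> closedin T C \<and> downset_in (topspace T) le C"
  unfolding closedin_def topspace_open_upset_topology openin_open_upset_topology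
    downset_in_def upset_in_def
  by blast

text \<open>The specialization order is \<open>le\<close> itself: a separating clopen upset excludes
  from the closure every \<open>y\<close> not below \<open>x\<close>, while an open upset around a
  \<open>y\<close> below \<open>x\<close> contains \<open>x\<close>.\<close>

lemma open_upset_closure_of_singleton:
  assumes P: "priestley_space T le" and x: "x \<in> topspace T"
  shows "open_upset_topology T le closure_of {x} = {y \<in> topspace T. le y x}"
proof -
  have "y \<in> open_upset_topology T le closure_of {x} \<longleftrightarrow> le y x" if y: "y \<in> topspace T" for y
  proof
    assume cl: "y \<in> open_upset_topology T le closure_of {x}"
    show "le y x"
    proof (rule ccontr)
      assume "\<not> le y x"
      then obtain U where "openin T U" "upset_in (topspace T) le U" "y \<in> U" "x \<notin> U"
        using P x y unfolding priestley_space_def by blast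
      then show False
        using cl unfolding in_closure_of openin_open_upset_topology by blast
    qed
  next
    assume "le y x"
    then show "y \<in> open_upset_topology T le closure_of {x}"
      using x y unfolding in_closure_of openin_open_upset_topology topspace_open_upset_topology
        upset_in_def by blast
  qed
  moreover have "open_upset_topology T le closure_of {x} \<subseteq> topspace T"
    by (metis closure_of_subset_topspace topspace_open_upset_topology)
  ultimately show ?thesis
    by blast
qed

text \<open>
  The generic point of an irreducible closed set lies in all clopen upsets meeting that set; such
  a point exists since, by irreducibility, these traces have the finite intersection property.
\<close>

lemma sober_open_upset_topology:
  assumes P: "priestley_space T le"
  shows "sober_space (open_upset_topology T le)"
  unfolding sober_space_def
proof (intro allI impI)
  fix C assume irr: "irreducible_closed (open_upset_topology T le) C"
  then have C: "closedin T C" "downset_in (topspace T) le C" "C \<noteq> {}"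
    unfolding irreducible_closed_def closedin_open_upset_topology by auto
  have split: "C = A \<or> C = B"
    if "closedin T A" "downset_in (topspace T) le A" "closedin T B" "downset_in (topspace T) le B"
      "C = A \<union> B" for A B
    using irr that unfolding irreducible_closed_def closedin_open_upset_topology by blast
  have CT: "C \<subseteq> topspace T"
    using C closedin_subset by blast
  define \<V> where "\<V> = {V. openin T V \<and> closedin T V \<and> upset_in (topspace T) le V \<and> V \<inter> C \<noteq> {}}"
  have clV: "V1 \<inter> V2 \<in> \<V>" if V: "V1 \<in> \<V>" "V2 \<in> \<V>" for V1 V2
  proof -
    have "V1 \<inter> V2 \<inter> C \<noteq> {}"
    proof
      assume "V1 \<inter> V2 \<inter> C = {}"
      \<comment> \<open>Removing an upset from a downset leaves a downset, so this is a
        decomposition of \<open>C\<close> into closed downsets. Irreducibility then makes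
        \<open>V1\<close> or \<open>V2\<close> miss \<open>C\<close>.\<close>
      then have "C = (C - V1) \<union> (C - V2)"
        by blast
      moreover have "closedin T (C - V)" "downset_in (topspace T) le (C - V)" if "V \<in> \<V>" for V
        using that C unfolding \<V>_def upset_in_def downset_in_def by blast+
      ultimately have "C = C - V1 \<or> C = C - V2"
        using V by (intro split) auto
      then show False
        using V unfolding \<V>_def by blast
    qed
    then show ?thesis
      using V unfolding \<V>_def upset_in_def by blast
  qed
  have TV: "topspace T \<in> \<V>"
    using C CT unfolding \<V>_def upset_in_def by auto
  have finV: "topspace T \<inter> \<Inter>\<F> \<in> \<V>" if "finite \<F>" "\<F> \<subseteq> \<V>" for \<F>
    using that
  proof (induction \<F>)
    case (insert V \<F>)
    then have "V \<in> \<V>" "topspace T \<inter> \<Inter>\<F> \<in> \<V>"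
      by auto
    then have "V \<inter> (topspace T \<inter> \<Inter>\<F>) \<in> \<V>"
      by (rule clV)
    then show ?case
      by (simp add: Int_left_commute)
  qed (simp add: TV)
  have "compactin T C"
    using P C by (intro closedin_compact_space) (auto simp: priestley_space_def)
  moreover have "\<forall>V\<in>\<V>. closedin T V"
    by (simp add: \<V>_def)
  moreover have "C \<inter> \<Inter>\<F> \<noteq> {}" if "finite \<F>" "\<F> \<subseteq> \<V>" for \<F>
    using finV[OF that] CT unfolding \<V>_def by blast
  ultimately have "C \<inter> \<Inter>\<V> \<noteq> {}"
    unfolding compactin_fip by blast
  then obtain x where x: "x \<in> C" "\<And>V. V \<in> \<V> \<Longrightarrow> x \<in> V"
    by blast
  have xT: "x \<in> topspace T"
    using x CT by blast
  have le: "le y x" if y: "y \<in> C" for y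
  proof (rule ccontr)
    assume "\<not> le y x"
    moreover have "y \<in> topspace T"
      using y CT by blast
    ultimately obtain V
      where "openin T V" "closedin T V" "upset_in (topspace T) le V" "y \<in> V" "x \<notin> V"
      using P xT unfolding priestley_space_def by meson
    moreover from this have "V \<in> \<V>"
      using y unfolding \<V>_def by blast
    ultimately show False
      using x(2) by blast
  qed
  have gen: "open_upset_topology T le closure_of {x} = C"
    unfolding open_upset_closure_of_singleton[OF P xT]
  proof
    show "{y \<in> topspace T. le y x} \<subseteq> C"
      using C(2) x(1) unfolding downset_in_def by blast
    show "C \<subseteq> {y \<in> topspace T. le y x}"
      using le CT by blast
  qed
  have uniq: "y = x"
    if y: "y \<in> topspace T" and eq: "open_upset_topology T le closure_of {y} = C" for y
  proof -
    have "{z \<in> topspace T. le z x} = {z \<in> topspace T. le z y}"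
      using eq gen unfolding open_upset_closure_of_singleton[OF P xT]
        open_upset_closure_of_singleton[OF P y] by simp
    moreover have "le x x" "le y y"
      using P xT y unfolding priestley_space_def reflp_on_def by simp_all
    ultimately have "le x y" "le y x"
      using xT y by blast+
    moreover have "antisymp_on (topspace T) le"
      using P by (simp add: priestley_space_def)
    ultimately show ?thesis
      using xT y by (simp add: antisymp_on_def)
  qed
  show "\<exists>!x. x \<in> topspace (open_upset_topology T le) \<and>
      open_upset_topology T le closure_of {x} = C"
    unfolding topspace_open_upset_topology using xT gen uniq by (intro ex1I[of _ x] conjI) blast+
qed

lemma spectral_open_upset_topology:
  "priestley_space T le \<Longrightarrow> spectral_space (open_upset_topology T le)"
  by (simp add: spectral_space_def sober_open_upset_topology coherent_open_upset_topology)

lemma spectral_open_downset_topology: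
  "priestley_space T le \<Longrightarrow> spectral_space (open_downset_topology T le)"
  by (simp add: open_downset_topology_dual spectral_open_upset_topology priestley_space_dual)

section \<open>Transfer along dual order-homeomorphisms\<close>

lemma dual_order_homeomorphism_image_upset:
  assumes "dual_order_homeomorphism T le H le' f" "U \<subseteq> topspace T"
  shows "downset_in (topspace H) le' (f ` U) \<longleftrightarrow> upset_in (topspace T) le U"
    and "upset_in (topspace H) le' (f ` U) \<longleftrightarrow> downset_in (topspace T) le U"
proof -
  have im: "f ` topspace T = topspace H" and inj: "inj_on f (topspace T)"
    using assms homeomorphic_imp_surjective_map homeomorphic_imp_injective_map
    unfolding dual_order_homeomorphism_def by blast+
  have ord: "le' (f y) (f x) \<longleftrightarrow> le x y" if "x \<in> topspace T" "y \<in> topspace T" for x y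
    using assms that unfolding dual_order_homeomorphism_def by blast
  have mem: "f x \<in> f ` U \<longleftrightarrow> x \<in> U" if "x \<in> topspace T" for x
    using inj_on_image_mem_iff[OF inj that assms(2)] .
  have UT: "x \<in> topspace T" if "x \<in> U" for x
    using assms(2) that by auto
  show "downset_in (topspace H) le' (f ` U) \<longleftrightarrow> upset_in (topspace T) le U"
    and "upset_in (topspace H) le' (f ` U) \<longleftrightarrow> downset_in (topspace T) le U"
    unfolding im[symmetric] downset_in_def upset_in_def ball_simps
    using assms(2) by (auto simp: ord mem UT)
qed

text \<open>Since \<open>f\<close> reverses the order, a clopen upset separating \<open>f x\<close>
  from \<open>f y\<close> is the image of a clopen downset: the complement of a clopen upset that
  contains \<open>y\<close> and misses \<open>x\<close>.\<close>

lemma priestley_space_dual_order_homeomorphism: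
  assumes P: "priestley_space T le" and f: "dual_order_homeomorphism T le H le' f"
  shows "priestley_space H le'"
proof -
  have hom: "homeomorphic_map T H f"
    and ord: "\<And>x y. x \<in> topspace T \<Longrightarrow> y \<in> topspace T \<Longrightarrow> le' (f y) (f x) \<longleftrightarrow> le x y"
    using f unfolding dual_order_homeomorphism_def by blast+
  have im: "topspace H = f ` topspace T"
    using homeomorphic_imp_surjective_map[OF hom] by simp
  have inj: "inj_on f (topspace T)"
    using homeomorphic_imp_injective_map[OF hom] .
  have "compact_space H"
    using P homeomorphic_compact_space[of T H] hom homeomorphic_map_imp_homeomorphic_space
    unfolding priestley_space_def by blast
  moreover have "reflp_on (topspace H) le'"
    using P ord unfolding im priestley_space_def reflp_on_def by simp
  moreover have "transp_on (topspace H) le'"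
    using P ord unfolding im priestley_space_def transp_on_def ball_simps by meson
  moreover have "antisymp_on (topspace H) le'"
    using P ord unfolding im priestley_space_def antisymp_on_def ball_simps by metis
  moreover have "\<exists>U. openin H U \<and> closedin H U \<and> upset_in (topspace H) le' U \<and> f x \<in> U \<and> f y \<notin> U"
    if xy: "x \<in> topspace T" "y \<in> topspace T" "\<not> le' (f x) (f y)" for x y
  proof -
    have "\<not> le y x"
      using ord xy by blast
    then obtain V where V: "openin T V" "closedin T V" "upset_in (topspace T) le V" "y \<in> V" "x \<notin> V"
      using P xy unfolding priestley_space_def by meson
    define W where "W = topspace T - V"
    have W: "openin T W" "closedin T W" "W \<subseteq> topspace T" "x \<in> W" "y \<notin> W"
      using V xy by (auto simp: W_def)
    have "downset_in (topspace T) le W"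
      using V unfolding W_def downset_in_def upset_in_def by blast
    then have "upset_in (topspace H) le' (f ` W)"
      using dual_order_homeomorphism_image_upset[OF f W(3)] by blast
    moreover have "openin H (f ` W)" "closedin H (f ` W)"
      using W homeomorphic_map_openness[OF hom W(3)] homeomorphic_map_closedness[OF hom W(3)]
      by auto
    moreover have "f x \<in> f ` W" "f y \<notin> f ` W"
      using W xy inj_on_image_mem_iff[OF inj _ W(3)] by auto
    ultimately show ?thesis
      by blast
  qed
  ultimately show ?thesis
    unfolding priestley_space_def by (simp add: im)
qed

text \<open>A homeomorphism determines the topology of its codomain. This identifies the hit and
  miss topologies inside the hit-or-miss topology without comparing subbases.\<close>

lemma homeomorphic_map_topology_eqI:
  assumes "homeomorphic_map X Y f" "topspace Z = topspace Y"
    "\<And>U. U \<subseteq> topspace X \<Longrightarrow> openin Z (f ` U) \<longleftrightarrow> openin X U"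
  shows "Y = Z"
proof -
  have "openin Y V \<longleftrightarrow> openin Z V" for V
  proof (cases "V \<subseteq> topspace Y")
    case True
    then obtain U where U: "U \<subseteq> topspace X" "V = f ` U"
      using homeomorphic_imp_surjective_map[OF assms(1)] by (metis subset_imageE)
    then show ?thesis
      using assms homeomorphic_map_openness[OF assms(1) U(1)] by simp
  next
    case False
    then show ?thesis
      using assms(2) openin_subset by metis
  qed
  then show ?thesis
    by (simp add: topology_eq)
qed

text \<open>The open upsets of \<open>T\<close> are carried by \<open>f\<close> exactly to the open
  downsets of \<open>H\<close>, so \<open>f\<close> is a homeomorphism onto both topologies and they
  coincide.\<close>

lemma dual_order_homeomorphism_open_upset:
  assumes f: "dual_order_homeomorphism T le H le' f"
    and hom: "homeomorphic_map (open_upset_topology T le) Y f"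
  shows "Y = open_downset_topology H le'"
proof (rule homeomorphic_map_topology_eqI[OF hom])
  have T: "homeomorphic_map T H f"
    using f by (simp add: dual_order_homeomorphism_def)
  show "topspace (open_downset_topology H le') = topspace Y"
    using homeomorphic_imp_surjective_map[OF hom] homeomorphic_imp_surjective_map[OF T]
    by (simp add: topspace_open_upset_topology topspace_open_downset_topology)
  fix U assume "U \<subseteq> topspace (open_upset_topology T le)"
  then show "openin (open_downset_topology H le') (f ` U) \<longleftrightarrow> openin (open_upset_topology T le) U"
    using dual_order_homeomorphism_image_upset[OF f] homeomorphic_map_openness[OF T]
    by (simp add: openin_open_downset_topology openin_open_upset_topology
        topspace_open_upset_topology)
qed

lemma dual_order_homeomorphism_open_downset:
  assumes f: "dual_order_homeomorphism T le H le' f"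
    and hom: "homeomorphic_map (open_downset_topology T le) Y f"
  shows "Y = open_upset_topology H le'"
proof -
  have "dual_order_homeomorphism T (\<lambda>x y. le y x) H (\<lambda>x y. le' y x) f"
    using f unfolding dual_order_homeomorphism_def by blast
  then have "Y = open_downset_topology H (\<lambda>x y. le' y x)"
    using hom by (intro dual_order_homeomorphism_open_upset) (auto simp: open_downset_topology_dual)
  then show ?thesis
    by (simp add: open_downset_topology_dual)
qed


section \<open>Topologies on families of sets\<close>

text \<open>The topology inherited from the Cantor cube when sets are identified with their
  characteristic functions. It is the common form of \<open>filters_topology\<close> and
  \<open>pf_topology\<close>.\<close>

definition family_topology :: "'a set set \<Rightarrow> 'a set topology" where
  "family_topology S =
     topology_on_by S (range (\<lambda>a. {x \<in> S. a \<in> x}) \<union> range (\<lambda>a. {x \<in> S. a \<notin> x}))"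

lemma topspace_family_topology: "topspace (family_topology S) = S"
  unfolding family_topology_def by (rule topspace_topology_on_by) auto

lemma openin_topology_on_by: "B \<in> \<B> \<Longrightarrow> openin (topology_on_by S \<B>) B"
  unfolding topology_on_by_def by (auto intro: topology_generated_by_Basis)

lemma continuous_map_topology_on_by:
  assumes "f \<in> topspace X \<rightarrow> S"
    "\<And>B. B \<in> \<B> \<Longrightarrow> openin X {x \<in> topspace X. f x \<in> B}"
  shows "continuous_map X (topology_on_by S \<B>) f"
  unfolding topology_on_by_def
proof (rule continuous_on_generated_topo)
  fix U assume "U \<in> insert S \<B>"
  \<comment> \<open>The carrier adjoined to the subbasis has all of \<open>topspace X\<close> as its
    preimage.\<close>
  moreover have "f -` S \<inter> topspace X = topspace X"
    using assms(1) by auto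
  moreover have "f -` U \<inter> topspace X = {x \<in> topspace X. f x \<in> U}"
    by auto
  ultimately show "openin X (f -` U \<inter> topspace X)"
    using assms(2) by auto
qed (use assms(1) in auto)

section \<open>Compactness, Priestley separation and bases for families of sets\<close>

lemma clopen_family_topology:
  "openin (family_topology S) {x \<in> S. a \<in> x}" "openin (family_topology S) {x \<in> S. a \<notin> x}"
  "closedin (family_topology S) {x \<in> S. a \<in> x}" "closedin (family_topology S) {x \<in> S. a \<notin> x}"
proof -
  show o: "openin (family_topology S) {x \<in> S. a \<in> x}" "openin (family_topology S) {x \<in> S. a \<notin> x}"
    unfolding family_topology_def by (rule openin_topology_on_by; blast)+
  have "S - {x \<in> S. a \<in> x} = {x \<in> S. a \<notin> x}" "S - {x \<in> S. a \<notin> x} = {x \<in> S. a \<in> x}"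
    by blast+
  with o show "closedin (family_topology S) {x \<in> S. a \<in> x}"
      "closedin (family_topology S) {x \<in> S. a \<notin> x}"
    unfolding closedin_def topspace_family_topology by auto
qed

lemma clopen_Collect_apply:
  "open {f :: 'a \<Rightarrow> bool. f a}" "closed {f :: 'a \<Rightarrow> bool. f a}"
proof -
  have c: "continuous_on UNIV (\<lambda>f :: 'a \<Rightarrow> bool. f a)"
    by (rule continuous_on_product_coordinates)
  have "open ((\<lambda>f :: 'a \<Rightarrow> bool. f a) -` {True})" "closed ((\<lambda>f :: 'a \<Rightarrow> bool. f a) -` {True})"
    using c by (intro open_vimage closed_vimage; simp add: open_discrete)+
  then show "open {f :: 'a \<Rightarrow> bool. f a}" "closed {f :: 'a \<Rightarrow> bool. f a}"
    by (simp_all add: vimage_def)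
qed

text \<open>The cube of all predicates is compact by Tychonoff. The predicates describing members of
  \<open>S\<close> form a closed, hence compact, subset, which \<open>Collect\<close> maps
  continuously onto \<open>S\<close>.\<close>

lemma compact_space_family_topology:
  assumes "closed {f :: 'a \<Rightarrow> bool. Collect f \<in> S}"
  shows "compact_space (family_topology S)"
proof -
  let ?C = "{f :: 'a \<Rightarrow> bool. Collect f \<in> S}"
  have "compact_space (product_topology (\<lambda>_::'a. euclidean :: bool topology) UNIV)"
    by (subst compact_space_product_topology) (simp add: compact_space_def finite_imp_compact)
  then have "compact_space (euclidean :: ('a \<Rightarrow> bool) topology)"
    by (simp add: euclidean_product_topology)
  then have "compactin euclidean ?C"
    using assms by (intro closedin_compact_space) auto
  then have "compact_space (top_of_set ?C)"
    by (simp add: compact_space_subtopology)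
  moreover have "continuous_map (top_of_set ?C) (family_topology S) Collect"
    unfolding family_topology_def
  proof (rule continuous_map_topology_on_by)
    fix B assume "B \<in> range (\<lambda>a. {x \<in> S. a \<in> x}) \<union> range (\<lambda>a. {x \<in> S. a \<notin> x})"
    then consider a where "B = {x \<in> S. a \<in> x}" | a where "B = {x \<in> S. a \<notin> x}"
      by auto
    then show "openin (top_of_set ?C) {f \<in> topspace (top_of_set ?C). Collect f \<in> B}"
    proof cases
      case 1
      then have "{f \<in> topspace (top_of_set ?C). Collect f \<in> B} = ?C \<inter> {f. f a}"
        by auto
      then show ?thesis
        using openin_open_Int[OF clopen_Collect_apply(1)] by simp
    next
      case 2
      then have "{f \<in> topspace (top_of_set ?C). Collect f \<in> B} = ?C \<inter> - {f. f a}"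
        by auto
      then show ?thesis
        using openin_open_Int[OF open_Compl[OF clopen_Collect_apply(2)]] by simp
    qed
  qed auto
  ultimately have "compactin (family_topology S) (Collect ` topspace (top_of_set ?C))"
    unfolding compact_space_def by (rule image_compactin)
  moreover have "Collect ` topspace (top_of_set ?C) = S"
  proof (rule subset_antisym)
    show "S \<subseteq> Collect ` topspace (top_of_set ?C)"
    proof
      fix x assume "x \<in> S"
      then show "x \<in> Collect ` topspace (top_of_set ?C)"
        by (intro image_eqI[of _ _ "\<lambda>a. a \<in> x"]) simp_all
    qed
  qed auto
  ultimately show ?thesis
    by (simp add: compact_space_def topspace_family_topology)
qed

lemma upset_in_Collect_mem: "upset_in S (\<subseteq>) {x \<in> S. a \<in> x}"
  and downset_in_Collect_notin: "downset_in S (\<subseteq>) {x \<in> S. a \<notin> x}"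
  by (auto simp: upset_in_def downset_in_def)

lemma priestley_space_family_topology:
  assumes "compact_space (family_topology S)"
  shows "priestley_space (family_topology S) (\<subseteq>)"
proof -
  have "\<exists>U. openin (family_topology S) U \<and> closedin (family_topology S) U \<and>
      upset_in S (\<subseteq>) U \<and> x \<in> U \<and> y \<notin> U" if xy: "x \<in> S" "y \<in> S" "\<not> x \<subseteq> y" for x y
  proof -
    obtain a where "a \<in> x" "a \<notin> y"
      using xy by blast
    then show ?thesis
      using xy clopen_family_topology[of S a] upset_in_Collect_mem[of S a]
      by (intro exI[of _ "{x \<in> S. a \<in> x}"]) auto
  qed
  then show ?thesis
    using assms unfolding priestley_space_def topspace_family_topology
    by (auto simp: reflp_on_def transp_on_def antisymp_on_def)
qed

text \<open>Each member of \<open>C\<close> has an element outside \<open>x\<close>, and compactness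
  leaves finitely many such elements. The intended \<open>C\<close> is the complement of an open
  downset around \<open>x\<close>.\<close>

lemma family_closed_upset_subcover:
  assumes cpt: "compact_space (family_topology S)"
    and C: "closedin (family_topology S) C" and x: "\<And>y. y \<in> C \<Longrightarrow> \<not> y \<subseteq> x"
  obtains A where "finite A" "A \<inter> x = {}" "C \<subseteq> (\<Union>a\<in>A. {y \<in> S. a \<in> y})"
proof -
  have "C \<subseteq> (\<Union>a\<in>- x. {y \<in> S. a \<in> y})"
    using x closedin_subset[OF C] by (force simp: topspace_family_topology)
  from compactin_indexed_subcover[OF closedin_compact_space[OF cpt C] clopen_family_topology(1) this]
  obtain A where "finite A" "A \<subseteq> - x" "C \<subseteq> (\<Union>a\<in>A. {y \<in> S. a \<in> y})" .
  then show thesis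
    using that[of A] by blast
qed

lemma family_open_downset_basis:
  assumes cpt: "compact_space (family_topology S)"
    and U: "openin (family_topology S) U" "downset_in S (\<subseteq>) U" and x: "x \<in> U"
  obtains A where "finite A" "A \<inter> x = {}" "{y \<in> S. A \<inter> y = {}} \<subseteq> U"
proof -
  have "closedin (family_topology S) (S - U)"
    using U by (metis closedin_diff closedin_topspace topspace_family_topology)
  moreover have "\<not> y \<subseteq> x" if "y \<in> S - U" for y
    using that U(2) x unfolding downset_in_def by blast
  ultimately obtain A where "finite A" "A \<inter> x = {}" "S - U \<subseteq> (\<Union>a\<in>A. {y \<in> S. a \<in> y})"
    using family_closed_upset_subcover[OF cpt] by metis
  then show thesis
    using that[of A] by blast
qed

text \<open>The order dual of the preceding cover argument: as \<open>U\<close> is an upset, a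
  member of \<open>S\<close> outside \<open>U\<close> omits some element of
  \<open>x\<close>.\<close>

lemma family_open_upset_basis:
  assumes cpt: "compact_space (family_topology S)"
    and U: "openin (family_topology S) U" "upset_in S (\<subseteq>) U" and x: "x \<in> U"
  obtains A where "finite A" "A \<subseteq> x" "{y \<in> S. A \<subseteq> y} \<subseteq> U"
proof -
  have cl: "closedin (family_topology S) (S - U)"
    using U by (metis closedin_diff closedin_topspace topspace_family_topology)
  have "S - U \<subseteq> (\<Union>a\<in>x. {y \<in> S. a \<notin> y})"
    using U(2) x unfolding upset_in_def by blast
  from compactin_indexed_subcover[OF closedin_compact_space[OF cpt cl] clopen_family_topology(2) this]
  obtain A where "finite A" "A \<subseteq> x" "S - U \<subseteq> (\<Union>a\<in>A. {y \<in> S. a \<notin> y})" .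
  then show thesis
    using that[of A] by blast
qed


section \<open>Filters\<close>

context
  fixes F :: "'a::bounded_lattice set"
  assumes F: "lattice_filter F"
begin

lemma lattice_filter_top: "top \<in> F"
  using F unfolding lattice_filter_def by (metis ex_in_conv top_greatest)

lemma lattice_filter_up: "a \<in> F \<Longrightarrow> a \<le> b \<Longrightarrow> b \<in> F"
  using F unfolding lattice_filter_def by blast

lemma lattice_filter_inf: "a \<in> F \<Longrightarrow> b \<in> F \<Longrightarrow> inf a b \<in> F"
  using F unfolding lattice_filter_def by blast

text \<open>Lets one element of \<open>F\<close> replace finitely many: by upward closure, any
  filter containing the lower bound contains all of \<open>A\<close>. For empty \<open>A\<close> the
  bound is \<open>top\<close>.\<close>

lemma lattice_filter_finite_lower_bound:
  assumes "finite A" "A \<subseteq> F"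
  shows "\<exists>b\<in>F. \<forall>a\<in>A. b \<le> a"
  using assms
proof (induction A)
  case empty
  then show ?case
    using lattice_filter_top by auto
next
  case (insert c A)
  then obtain b where "b \<in> F" "\<forall>a\<in>A. b \<le> a"
    by auto
  then show ?case
    using insert lattice_filter_inf[of b c] by (intro bexI[of _ "inf b c"]) (auto intro: le_infI1)
qed

end

section \<open>Prime filters and their separation property\<close>

lemma prime_filterD:
  assumes "prime_filter x"
  shows "lattice_filter x" "sup a b \<in> x \<longleftrightarrow> a \<in> x \<or> b \<in> x" "bot \<notin> x"
proof -
  show x: "lattice_filter x"
    using assms by (simp add: prime_filter_def)
  show "sup a b \<in> x \<longleftrightarrow> a \<in> x \<or> b \<in> x"
    using assms lattice_filter_up[OF x] unfolding prime_filter_def by (metis sup_ge1 sup_ge2)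
  show "bot \<notin> x"
    using assms lattice_filter_up[OF x] unfolding prime_filter_def by (metis UNIV_eq_I bot_least)
qed

text \<open>Take the join of \<open>A\<close>, with \<open>bot\<close> for the empty set. Primeness
  turns joins into disjunctions, so finite intersections of sets \<open>pf_minus a\<close> are again
  of this form.\<close>

lemma finite_prime_join:
  fixes A :: "'a::bounded_lattice set"
  assumes "finite A"
  shows "\<exists>b. \<forall>x. prime_filter x \<longrightarrow> (b \<in> x \<longleftrightarrow> A \<inter> x \<noteq> {})"
  using assms
proof (induction A)
  case empty
  show ?case
    using prime_filterD(3) by (intro exI[of _ bot]) auto
next
  case (insert c A)
  then obtain b where "\<forall>x. prime_filter x \<longrightarrow> (b \<in> x \<longleftrightarrow> A \<inter> x \<noteq> {})"
    by blast
  then show ?case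
    using prime_filterD(2) by (intro exI[of _ "sup c b"]) auto
qed

text \<open>Zorn's lemma gives a filter \<open>M\<close> maximal among those that contain
  \<open>F\<close> and omit \<open>a\<close>; maximality together with distributivity makes it
  prime.\<close>

lemma prime_filter_separation:
  fixes F :: "'a::{bounded_lattice, distrib_lattice} set"
  assumes F: "lattice_filter F" and a: "a \<notin> F"
  obtains x where "prime_filter x" "F \<subseteq> x" "a \<notin> x"
proof -
  define \<G> where "\<G> = {G. lattice_filter G \<and> F \<subseteq> G \<and> a \<notin> G}"
  have "\<Union>\<C> \<in> \<G>" if C: "\<C> \<noteq> {}" "subset.chain \<G> \<C>" for \<C>
  proof -
    have sub: "\<C> \<subseteq> \<G>" and lin: "\<And>G H. G \<in> \<C> \<Longrightarrow> H \<in> \<C> \<Longrightarrow> G \<subseteq> H \<or> H \<subseteq> G"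
      using C unfolding subset_chain_def by auto
    have "inf b c \<in> \<Union>\<C>" if bc: "b \<in> \<Union>\<C>" "c \<in> \<Union>\<C>" for b c
    proof -
      obtain G where "G \<in> \<C>" "b \<in> G" "c \<in> G"
        using bc lin by blast
      then show ?thesis
        using sub lattice_filter_inf[of G] unfolding \<G>_def by blast
    qed
    moreover have "c \<in> \<Union>\<C>" if "b \<in> \<Union>\<C>" "b \<le> c" for b c
      using that sub lattice_filter_up unfolding \<G>_def by blast
    moreover obtain G where "G \<in> \<C>"
      using C by blast
    moreover from this have "F \<subseteq> G" "G \<noteq> {}"
      using sub unfolding \<G>_def lattice_filter_def by auto
    ultimately have "lattice_filter (\<Union>\<C>)" "F \<subseteq> \<Union>\<C>"
      unfolding lattice_filter_def by blast+
    then show ?thesis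
      using sub unfolding \<G>_def by blast
  qed
  moreover have "F \<in> \<G>"
    using F a by (simp add: \<G>_def)
  ultimately obtain M where M: "M \<in> \<G>" and max: "\<And>G. G \<in> \<G> \<Longrightarrow> M \<subseteq> G \<Longrightarrow> G = M"
    using subset_Zorn_nonempty[of \<G>] by blast
  have fM: "lattice_filter M" and aM: "a \<notin> M" and FM: "F \<subseteq> M"
    using M by (auto simp: \<G>_def)
  have ext: "\<exists>m\<in>M. inf m b \<le> a" if "b \<notin> M" for b
  proof (rule ccontr)
    assume neg: "\<not> (\<exists>m\<in>M. inf m b \<le> a)"
    \<comment> \<open>The filter generated by \<open>M\<close> and \<open>b\<close>. If it omits
      \<open>a\<close>, maximality puts \<open>b\<close> into \<open>M\<close>.\<close>
    define G where "G = {z. \<exists>m\<in>M. inf m b \<le> z}"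
    have "M \<subseteq> G"
      unfolding G_def by (auto intro: le_infI1)
    have "inf z w \<in> G" if "z \<in> G" "w \<in> G" for z w
    proof -
      obtain m n where "m \<in> M" "inf m b \<le> z" "n \<in> M" "inf n b \<le> w"
        using \<open>z \<in> G\<close> \<open>w \<in> G\<close> unfolding G_def by blast
      moreover from this have "inf (inf m n) b \<le> inf z w"
        by (meson inf.boundedI inf.cobounded1 inf.cobounded2 inf_mono order.refl order_trans)
      ultimately show ?thesis
        unfolding G_def using lattice_filter_inf[OF fM] by blast
    qed
    moreover have "w \<in> G" if "z \<in> G" "z \<le> w" for z w
      using that unfolding G_def by (blast intro: order_trans)
    ultimately have "lattice_filter G"
      using \<open>M \<subseteq> G\<close> lattice_filter_top[OF fM] unfolding lattice_filter_def by blast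
    then have "G \<in> \<G>"
      using \<open>M \<subseteq> G\<close> FM neg unfolding \<G>_def G_def by blast
    moreover have "b \<in> G"
      using lattice_filter_top[OF fM] unfolding G_def by auto
    ultimately show False
      using max \<open>M \<subseteq> G\<close> that by blast
  qed
  have "b \<in> M \<or> c \<in> M" if bc: "sup b c \<in> M" for b c
  proof (rule ccontr)
    assume "\<not> (b \<in> M \<or> c \<in> M)"
    then obtain m n where mn: "m \<in> M" "inf m b \<le> a" "n \<in> M" "inf n c \<le> a"
      using ext by blast
    \<comment> \<open>The common witness \<open>inf m n\<close> serves both \<open>b\<close> and
      \<open>c\<close>, so distributivity produces an element of \<open>M\<close> below
      \<open>a\<close>.\<close>
    have "inf (inf m n) b \<le> a" "inf (inf m n) c \<le> a"
      using mn by (meson inf.cobounded1 inf.cobounded2 inf_mono order.refl order_trans)+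
    then have "inf (inf m n) (sup b c) \<le> a"
      by (simp add: inf_sup_distrib1)
    then show False
      using aM bc mn lattice_filter_inf[OF fM] lattice_filter_up[OF fM] by blast
  qed
  then have "prime_filter M"
    using fM aM unfolding prime_filter_def by blast
  then show thesis
    using that FM aM by blast
qed

section \<open>Compactness and bases of the spaces of filters and prime filters\<close>

lemma filters_topology_eq: "filters_topology = family_topology filters"
  by (simp add: filters_topology_def family_topology_def filters_up_def filters_down_def)

lemma pf_topology_eq: "pf_topology = family_topology prime_filters"
  by (simp add: pf_topology_def family_topology_def pf_plus_def pf_minus_def)

text \<open>Nonemptiness, an open condition on \<open>F\<close>, becomes the clopen condition
  \<open>top \<in> F\<close>. All conditions are now closed in the cube, as they constrain finitely
  many coordinates at a time.\<close>

lemma lattice_filter_alt: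
  "lattice_filter F \<longleftrightarrow> top \<in> F \<and> (\<forall>a b. a \<in> F \<longrightarrow> a \<le> b \<longrightarrow> b \<in> F) \<and>
     (\<forall>a b. a \<in> F \<longrightarrow> b \<in> F \<longrightarrow> inf a b \<in> F)"
  (is "_ \<longleftrightarrow> ?R")
proof
  assume "lattice_filter F"
  then show ?R
    using lattice_filter_top[of F] by (simp add: lattice_filter_def)
qed (auto simp: lattice_filter_def)

text \<open>In the same spirit, properness becomes a condition on the single coordinate
  \<open>bot\<close>.\<close>

lemma prime_filter_alt:
  "prime_filter x \<longleftrightarrow> lattice_filter x \<and> bot \<notin> x \<and> (\<forall>a b. sup a b \<in> x \<longrightarrow> a \<in> x \<or> b \<in> x)"
  (is "_ \<longleftrightarrow> ?R")
proof
  assume "prime_filter x"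
  then show ?R
    using prime_filterD(3)[of x] by (simp add: prime_filter_def)
qed (auto simp: prime_filter_def)

lemma closed_filters: "closed {f :: 'a::bounded_lattice \<Rightarrow> bool. Collect f \<in> filters}"
proof -
  have "{f :: 'a \<Rightarrow> bool. Collect f \<in> filters} = {f. f top \<and> (\<forall>a b. f a \<longrightarrow> a \<le> b \<longrightarrow> f b) \<and>
      (\<forall>a b. f a \<longrightarrow> f b \<longrightarrow> f (inf a b))}"
    by (simp add: filters_def lattice_filter_alt)
  moreover have "closed {f :: 'a \<Rightarrow> bool. f a \<longrightarrow> a \<le> b \<longrightarrow> f b}" for a b
    \<comment> \<open>The inequality does not depend on \<open>f\<close>: the conclusion of the
      implication is the coordinate condition at \<open>b\<close> or always true.\<close>
    by (rule closed_Collect_imp[OF clopen_Collect_apply(1)])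
      (cases "a \<le> b"; simp add: clopen_Collect_apply)
  moreover have "closed {f :: 'a \<Rightarrow> bool. f a \<longrightarrow> f b \<longrightarrow> f (inf a b)}" for a b
    by (rule closed_Collect_imp[OF clopen_Collect_apply(1)
          closed_Collect_imp[OF clopen_Collect_apply(1) clopen_Collect_apply(2)]])
  ultimately show ?thesis
    by (simp only: closed_Collect_conj closed_Collect_all clopen_Collect_apply)
qed

lemma closed_prime_filters: "closed {f :: 'a::bounded_lattice \<Rightarrow> bool. Collect f \<in> prime_filters}"
proof -
  have "{f :: 'a \<Rightarrow> bool. Collect f \<in> prime_filters} =
      {f. Collect f \<in> filters \<and> \<not> f bot \<and> (\<forall>a b. f (sup a b) \<longrightarrow> f a \<or> f b)}"
    by (simp add: prime_filters_def filters_def prime_filter_alt)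
  moreover have "closed {f :: 'a \<Rightarrow> bool. f (sup a b) \<longrightarrow> f a \<or> f b}" for a b
    by (rule closed_Collect_imp[OF clopen_Collect_apply(1)
          closed_Collect_disj[OF clopen_Collect_apply(2) clopen_Collect_apply(2)]])
  ultimately show ?thesis
    by (simp add: closed_Collect_conj closed_Collect_all closed_Collect_neg clopen_Collect_apply
        closed_filters)
qed

lemma compact_space_filters_topology: "compact_space filters_topology"
  unfolding filters_topology_eq by (rule compact_space_family_topology[OF closed_filters])

lemma compact_space_pf_topology: "compact_space pf_topology"
  unfolding pf_topology_eq by (rule compact_space_family_topology[OF closed_prime_filters])

lemma openin_open_upset_filters_up:
  "openin (open_upset_topology filters_topology (\<subseteq>)) (filters_up a)"
  unfolding filters_topology_eq openin_open_upset_topology topspace_family_topology filters_up_def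
  by (simp add: clopen_family_topology upset_in_Collect_mem)

lemma openin_open_downset_filters_down:
  "openin (open_downset_topology filters_topology (\<subseteq>)) (filters_down a)"
  unfolding filters_topology_eq openin_open_downset_topology topspace_family_topology filters_down_def
  by (simp add: clopen_family_topology downset_in_Collect_notin)

lemma openin_pf_down_pf_minus: "openin pf_down_topology (pf_minus a)"
  unfolding pf_down_topology_def pf_topology_eq openin_open_downset_topology
    topspace_family_topology pf_minus_def
  by (simp add: clopen_family_topology downset_in_Collect_notin)

text \<open>Goes through the finer topology \<open>pf_topology\<close>, where the set is closed; in
  \<open>pf_down_topology\<close> itself it need not be closed.\<close>

lemma compactin_pf_down_pf_minus: "compactin pf_down_topology (pf_minus a)"
proof (rule compactin_coarser)
  have "closedin pf_topology (pf_minus a)"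
    unfolding pf_topology_eq pf_minus_def by (rule clopen_family_topology)
  with compact_space_pf_topology show "compactin pf_topology (pf_minus a)"
    by (rule closedin_compact_space)
qed (auto simp: pf_down_topology_def openin_open_downset_topology topspace_open_downset_topology)

lemma open_upset_filters_basis:
  fixes F :: "'a::bounded_lattice set"
  assumes U: "openin (open_upset_topology filters_topology (\<subseteq>)) U" and F: "F \<in> U"
  obtains a where "a \<in> F" "filters_up a \<subseteq> U"
proof -
  have oU: "openin (family_topology filters) U" "upset_in filters (\<subseteq>) U"
    using U unfolding openin_open_upset_topology filters_topology_eq topspace_family_topology by auto
  obtain A where A: "finite A" "A \<subseteq> F" "{G \<in> filters. A \<subseteq> G} \<subseteq> U"
    using family_open_upset_basis[OF compact_space_filters_topology[unfolded filters_topology_eq] oU F] .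
  have "lattice_filter F"
    using oU F unfolding upset_in_def filters_def by blast
  then obtain b where "b \<in> F" "\<forall>a\<in>A. b \<le> a"
    using lattice_filter_finite_lower_bound A by blast
  moreover from this have "filters_up b \<subseteq> {G \<in> filters. A \<subseteq> G}"
    unfolding filters_up_def filters_def using lattice_filter_up by blast
  ultimately show thesis
    using that A by blast
qed

text \<open>A finite set \<open>A\<close> stays here, in contrast to the upset case: a filter that
  omits two elements may contain their join.\<close>

lemma open_downset_filters_basis:
  fixes F :: "'a::bounded_lattice set"
  assumes U: "openin (open_downset_topology filters_topology (\<subseteq>)) U" and F: "F \<in> U"
  obtains A where "finite A" "A \<inter> F = {}" "{G \<in> filters. A \<inter> G = {}} \<subseteq> U"
proof -
  have oU: "openin (family_topology filters) U" "downset_in filters (\<subseteq>) U"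
    using U unfolding openin_open_downset_topology filters_topology_eq topspace_family_topology by auto
  show thesis
    using family_open_downset_basis[OF compact_space_filters_topology[unfolded filters_topology_eq] oU F]
      that .
qed

text \<open>For prime filters the finite set can be merged into its join \<open>b\<close>, so the
  sets \<open>pf_minus b\<close> form a basis.\<close>

lemma pf_down_open_basis:
  assumes U: "openin pf_down_topology U" and x: "x \<in> U"
  obtains b where "b \<notin> x" "pf_minus b \<subseteq> U"
proof -
  have oU: "openin (family_topology prime_filters) U" "downset_in prime_filters (\<subseteq>) U"
    using U unfolding pf_down_topology_def openin_open_downset_topology pf_topology_eq
      topspace_family_topology by auto
  obtain A where A: "finite A" "A \<inter> x = {}" "{y \<in> prime_filters. A \<inter> y = {}} \<subseteq> U"
    using family_open_downset_basis[OF compact_space_pf_topology[unfolded pf_topology_eq] oU x] .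
  obtain b where b: "\<forall>x. prime_filter x \<longrightarrow> (b \<in> x \<longleftrightarrow> A \<inter> x \<noteq> {})"
    using finite_prime_join[OF A(1)] by blast
  have "prime_filter x"
    using oU x unfolding downset_in_def prime_filters_def by blast
  then have "b \<notin> x"
    using b A by blast
  moreover have "pf_minus b \<subseteq> {y \<in> prime_filters. A \<inter> y = {}}"
    using b unfolding pf_minus_def prime_filters_def by blast
  ultimately show thesis
    using that A by blast
qed


section \<open>The map \<open>\<Gamma>\<close> and its inverse\<close>

text \<open>For a set of prime filters this is the intersection of its members; the empty set gives
  \<open>UNIV\<close>, the improper filter.\<close>

definition Gamma_inv :: "'a::bounded_lattice set set \<Rightarrow> 'a set" where
  "Gamma_inv C = {a. C \<subseteq> pf_plus a}"

text \<open>Nonemptiness of \<open>F\<close> keeps the intersection inside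
  \<open>prime_filters\<close>; over an empty index set it would be \<open>UNIV\<close>.\<close>

lemma Gamma_map_eq: "F \<in> filters \<Longrightarrow> Gamma_map F = {x \<in> prime_filters. F \<subseteq> x}"
  by (auto simp: Gamma_map_def pf_plus_def filters_def lattice_filter_def)

lemma Gamma_map_subset: "F \<in> filters \<Longrightarrow> Gamma_map F \<subseteq> prime_filters"
  by (auto simp: Gamma_map_eq)

lemma Gamma_map_antimono:
  "F \<in> filters \<Longrightarrow> G \<in> filters \<Longrightarrow> F \<subseteq> G \<Longrightarrow> Gamma_map G \<subseteq> Gamma_map F"
  by (auto simp: Gamma_map_eq)

lemma Gamma_map_closed:
  assumes "F \<in> filters"
  shows "Gamma_map F \<in> closed_sets pf_down_topology"
proof -
  have "closedin pf_topology (Gamma_map F)"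
    unfolding Gamma_map_def
  proof (rule closedin_Inter)
    show "pf_plus ` F \<noteq> {}"
      using assms by (auto simp: filters_def lattice_filter_def)
    show "closedin pf_topology K" if "K \<in> pf_plus ` F" for K
      using that unfolding pf_topology_eq pf_plus_def by (auto simp: clopen_family_topology)
  qed
  then show ?thesis
    using assms unfolding closed_sets_pf_down_topology
    by (auto simp: Gamma_map_eq upset_in_def)
qed

lemma closed_sets_pf_down_subset: "C \<in> closed_sets pf_down_topology \<Longrightarrow> C \<subseteq> prime_filters"
  by (simp add: closed_sets_pf_down_topology upset_in_def)

lemma disjoint_pf_minus_iff: "C \<subseteq> prime_filters \<Longrightarrow> C \<inter> pf_minus a = {} \<longleftrightarrow> a \<in> Gamma_inv C"
  by (auto simp: Gamma_inv_def pf_plus_def pf_minus_def)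

lemma Gamma_inv_filter:
  assumes "C \<subseteq> prime_filters"
  shows "Gamma_inv C \<in> filters"
proof -
  have "lattice_filter x" if "x \<in> C" for x
    using that assms by (auto simp: prime_filters_def prime_filter_def)
  moreover have "Gamma_inv C = {a. \<forall>x\<in>C. a \<in> x}"
    using assms by (auto simp: Gamma_inv_def pf_plus_def)
  ultimately show ?thesis
    by (auto simp: filters_def lattice_filter_alt)
qed

lemma Gamma_inv_Gamma_map:
  fixes F :: "'a::{bounded_lattice, distrib_lattice} set"
  assumes "F \<in> filters"
  shows "Gamma_inv (Gamma_map F) = F"
proof -
  have "a \<in> F" if a: "Gamma_map F \<subseteq> pf_plus a" for a
  proof (rule ccontr)
    assume aF: "a \<notin> F"
    have "lattice_filter F"
      using assms by (simp add: filters_def)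
    then obtain x where x: "prime_filter x" "F \<subseteq> x" "a \<notin> x"
      using prime_filter_separation[OF _ aF] by metis
    then have "x \<in> Gamma_map F"
      by (simp add: Gamma_map_eq[OF assms] prime_filters_def)
    then show False
      using a x(3) by (auto simp: pf_plus_def)
  qed
  then show ?thesis
    by (auto simp: Gamma_inv_def Gamma_map_def)
qed

text \<open>A prime filter \<open>x\<close> outside \<open>C\<close> has a neighbourhood
  \<open>pf_minus b\<close> disjoint from \<open>C\<close>. Then \<open>b\<close> lies in
  \<open>Gamma_inv C\<close> but not in \<open>x\<close>.\<close>

lemma Gamma_map_Gamma_inv:
  assumes C: "C \<in> closed_sets pf_down_topology"
  shows "Gamma_map (Gamma_inv C) = C"
proof -
  have sub: "C \<subseteq> prime_filters"
    using C by (rule closed_sets_pf_down_subset)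
  have "x \<in> C" if x: "x \<in> prime_filters" "Gamma_inv C \<subseteq> x" for x
  proof (rule ccontr)
    assume "x \<notin> C"
    then have "x \<in> prime_filters - C"
      using x by simp
    moreover have "openin pf_down_topology (prime_filters - C)"
      using C by (simp add: closed_sets_def closedin_def pf_down_topology_def
          topspace_open_downset_topology topspace_pf_topology)
    ultimately obtain b where b: "b \<notin> x" "pf_minus b \<subseteq> prime_filters - C"
      using pf_down_open_basis[of "prime_filters - C" x] by metis
    then have "C \<inter> pf_minus b = {}"
      by auto
    then have "b \<in> Gamma_inv C"
      by (simp add: disjoint_pf_minus_iff[OF sub])
    then show False
      using b(1) x(2) by auto
  qed
  moreover have "C \<subseteq> Gamma_map (Gamma_inv C)"
    by (auto simp: Gamma_map_def Gamma_inv_def)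
  ultimately show ?thesis
    by (auto simp: Gamma_map_eq[OF Gamma_inv_filter[OF sub]])
qed

lemma homeomorphic_map_Gamma:
  fixes Y :: "'a::{bounded_lattice, distrib_lattice} set set topology"
  assumes "topspace Y = closed_sets pf_down_topology" "topspace X = filters"
    and "continuous_map X Y Gamma_map" "continuous_map Y X Gamma_inv"
  shows "homeomorphic_map X Y Gamma_map"
  unfolding homeomorphic_map_maps homeomorphic_maps_def
  using assms
  by (intro exI[of _ Gamma_inv]) (simp add: Gamma_inv_Gamma_map Gamma_map_Gamma_inv)

section \<open>Continuity of \<open>Gamma_map\<close> and \<open>Gamma_inv\<close>\<close>

lemma Gamma_map_disjoint_pf_minus:
  fixes F :: "'a::{bounded_lattice, distrib_lattice} set"
  shows "F \<in> filters \<Longrightarrow> Gamma_map F \<inter> pf_minus a = {} \<longleftrightarrow> a \<in> F"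
  by (simp add: disjoint_pf_minus_iff Gamma_map_subset Gamma_inv_Gamma_map)

lemma openin_miss_pf_minus:
  "openin (miss_topology pf_down_topology) (miss_set pf_down_topology (pf_minus a))"
  unfolding miss_topology_def
  by (rule openin_topology_on_by) (auto intro: compactin_pf_down_pf_minus)

lemma openin_hit_pf_minus:
  "openin (hit_topology pf_down_topology) (hit_set pf_down_topology (pf_minus a))"
  unfolding hit_topology_def
  by (rule openin_topology_on_by) (auto intro: openin_pf_down_pf_minus)

lemma miss_set_pf_minus:
  "miss_set pf_down_topology (pf_minus a) = {C \<in> closed_sets pf_down_topology. a \<in> Gamma_inv C}"
  unfolding miss_set_def
  by (intro Collect_cong conj_cong refl)
    (simp add: disjoint_pf_minus_iff closed_sets_pf_down_subset)

lemma hit_set_pf_minus: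
  "hit_set pf_down_topology (pf_minus a) = {C \<in> closed_sets pf_down_topology. a \<notin> Gamma_inv C}"
  unfolding hit_set_def
  by (intro Collect_cong conj_cong refl)
    (simp add: disjoint_pf_minus_iff closed_sets_pf_down_subset)

lemma Gamma_inv_closed: "C \<in> closed_sets pf_down_topology \<Longrightarrow> Gamma_inv C \<in> filters"
  by (simp add: Gamma_inv_filter closed_sets_pf_down_subset)

text \<open>If \<open>Gamma_map F\<close> misses \<open>K\<close>, no member of \<open>K\<close>
  contains \<open>F\<close>, so the sets \<open>pf_minus a\<close> with \<open>a \<in> F\<close>
  cover \<open>K\<close>. A lower bound \<open>b\<close> in \<open>F\<close> of a finite subcover's
  indices gives the neighbourhood \<open>filters_up b\<close>.\<close>

lemma continuous_map_Gamma_miss: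
  "continuous_map (open_upset_topology filters_topology (\<subseteq>))
     (miss_topology pf_down_topology :: 'a::{bounded_lattice, distrib_lattice} set set topology) Gamma_map"
  unfolding miss_topology_def
proof (rule continuous_map_topology_on_by; unfold topspace_open_upset_topology topspace_filters_topology)
  fix B :: "'a set set set" assume "B \<in> {miss_set pf_down_topology K |K. compactin pf_down_topology K}"
  then obtain K where B: "B = miss_set pf_down_topology K" and K: "compactin pf_down_topology K"
    by blast
  show "openin (open_upset_topology filters_topology (\<subseteq>)) {F \<in> filters. Gamma_map F \<in> B}"
  proof (subst openin_subopen, intro ballI)
    fix F :: "'a set" assume "F \<in> {F \<in> filters. Gamma_map F \<in> B}"
    then have F: "F \<in> filters" and FK: "Gamma_map F \<inter> K = {}"
      by (auto simp: B miss_set_def)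
    have KX: "K \<subseteq> prime_filters"
      using compactin_subset_topspace[OF K]
      by (simp add: pf_down_topology_def topspace_open_downset_topology topspace_pf_topology)
    then have cover: "K \<subseteq> (\<Union>a\<in>F. pf_minus a)"
      using FK unfolding Gamma_map_eq[OF F] pf_minus_def by blast
    obtain A where A: "finite A" "A \<subseteq> F" "K \<subseteq> (\<Union>a\<in>A. pf_minus a)"
      using compactin_indexed_subcover[OF K openin_pf_down_pf_minus cover] .
    then obtain b where b: "b \<in> F" "\<forall>a\<in>A. b \<le> a"
      using lattice_filter_finite_lower_bound F unfolding filters_def by blast
    have "Gamma_map G \<in> B" if G: "G \<in> filters_up b" for G
    proof -
      have GF: "G \<in> filters" and "b \<in> G"
        using G by (auto simp: filters_up_def)
      then have "A \<subseteq> G"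
        using b lattice_filter_up[of G] unfolding filters_def by blast
      then have "Gamma_map G \<inter> K = {}"
        using A(3) unfolding Gamma_map_eq[OF GF] pf_minus_def by blast
      then show ?thesis
        using Gamma_map_closed[OF GF] by (simp add: B miss_set_def)
    qed
    then show "\<exists>T. openin (open_upset_topology filters_topology (\<subseteq>)) T \<and> F \<in> T \<and>
        T \<subseteq> {F \<in> filters. Gamma_map F \<in> B}"
      using openin_open_upset_filters_up[of b] b F
      by (intro exI[of _ "filters_up b"]) (auto simp: filters_up_def)
  qed
qed (use Gamma_map_closed in auto)

lemma continuous_map_Gamma_inv_miss:
  "continuous_map (miss_topology pf_down_topology) (open_upset_topology filters_topology (\<subseteq>)) Gamma_inv"
  unfolding continuous_map topspace_miss_topology topspace_open_upset_topology topspace_filters_topology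
proof (intro conjI allI impI)
  fix U :: "'a set set" assume U: "openin (open_upset_topology filters_topology (\<subseteq>)) U"
  show "openin (miss_topology pf_down_topology) {C \<in> closed_sets pf_down_topology. Gamma_inv C \<in> U}"
  proof (subst openin_subopen, intro ballI)
    fix C :: "'a set set" assume C: "C \<in> {C \<in> closed_sets pf_down_topology. Gamma_inv C \<in> U}"
    then obtain a where "a \<in> Gamma_inv C" "filters_up a \<subseteq> U"
      using open_upset_filters_basis[OF U] by blast
    then show "\<exists>T. openin (miss_topology pf_down_topology) T \<and> C \<in> T \<and>
        T \<subseteq> {C \<in> closed_sets pf_down_topology. Gamma_inv C \<in> U}"
      using C openin_miss_pf_minus[of a] Gamma_inv_closed
      by (intro exI[of _ "miss_set pf_down_topology (pf_minus a)"])
        (auto simp: miss_set_pf_minus filters_up_def)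
  qed
qed (use Gamma_inv_closed in auto)

text \<open>A point of \<open>Gamma_map F\<close> in \<open>U\<close> has a neighbourhood
  \<open>pf_minus b\<close> inside \<open>U\<close>. Every filter omitting \<open>b\<close> has an
  image that meets \<open>pf_minus b\<close>, hence \<open>U\<close>.\<close>

lemma continuous_map_Gamma_hit:
  "continuous_map (open_downset_topology filters_topology (\<subseteq>))
     (hit_topology pf_down_topology :: 'a::{bounded_lattice, distrib_lattice} set set topology) Gamma_map"
  unfolding hit_topology_def
proof (rule continuous_map_topology_on_by; unfold topspace_open_downset_topology topspace_filters_topology)
  fix B :: "'a set set set" assume "B \<in> {hit_set pf_down_topology U |U. openin pf_down_topology U}"
  then obtain U where B: "B = hit_set pf_down_topology U" and U: "openin pf_down_topology U"
    by blast
  show "openin (open_downset_topology filters_topology (\<subseteq>)) {F \<in> filters. Gamma_map F \<in> B}"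
  proof (subst openin_subopen, intro ballI)
    fix F :: "'a set" assume "F \<in> {F \<in> filters. Gamma_map F \<in> B}"
    then obtain x where F: "F \<in> filters" and x: "x \<in> Gamma_map F" "x \<in> U"
      by (auto simp: B hit_set_def)
    obtain b where b: "b \<notin> x" "pf_minus b \<subseteq> U"
      using pf_down_open_basis[OF U x(2)] by blast
    have "Gamma_map G \<in> B" if G: "G \<in> filters_down b" for G
    proof -
      have GF: "G \<in> filters" and "b \<notin> G"
        using G by (auto simp: filters_down_def)
      then have "Gamma_map G \<inter> pf_minus b \<noteq> {}"
        using Gamma_map_disjoint_pf_minus by blast
      then show ?thesis
        using Gamma_map_closed[OF GF] b by (auto simp: B hit_set_def)
    qed
    moreover have "F \<in> filters_down b"
      using F x b by (auto simp: filters_down_def Gamma_map_eq)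
    ultimately show "\<exists>T. openin (open_downset_topology filters_topology (\<subseteq>)) T \<and> F \<in> T \<and>
        T \<subseteq> {F \<in> filters. Gamma_map F \<in> B}"
      using openin_open_downset_filters_down[of b]
      by (intro exI[of _ "filters_down b"]) (auto simp: filters_down_def)
  qed
qed (use Gamma_map_closed in auto)

lemma continuous_map_Gamma_inv_hit:
  "continuous_map (hit_topology pf_down_topology) (open_downset_topology filters_topology (\<subseteq>)) Gamma_inv"
  unfolding continuous_map topspace_hit_topology topspace_open_downset_topology topspace_filters_topology
proof (intro conjI allI impI)
  fix U :: "'a set set" assume U: "openin (open_downset_topology filters_topology (\<subseteq>)) U"
  show "openin (hit_topology pf_down_topology) {C \<in> closed_sets pf_down_topology. Gamma_inv C \<in> U}"
  proof (subst openin_subopen, intro ballI)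
    fix C :: "'a set set" assume C: "C \<in> {C \<in> closed_sets pf_down_topology. Gamma_inv C \<in> U}"
    then obtain A where A: "finite A" "A \<inter> Gamma_inv C = {}" "{G \<in> filters. A \<inter> G = {}} \<subseteq> U"
      using open_downset_filters_basis[OF U] by blast
    \<comment> \<open>The hit sets of the finitely many \<open>a \<in> A\<close> express that
      \<open>Gamma_inv\<close> avoids \<open>A\<close>; for empty \<open>A\<close> the first factor
      makes \<open>W\<close> the whole space.\<close>
    define W where "W = topspace (hit_topology pf_down_topology) \<inter>
      \<Inter>((\<lambda>a. hit_set pf_down_topology (pf_minus a)) ` A)"
    have "openin (hit_topology pf_down_topology) W"
      using A(1) openin_hit_pf_minus unfolding W_def by (intro openin_Int_Inter) auto
    moreover have "C \<in> W"
      using A C by (auto simp: W_def hit_set_pf_minus topspace_hit_topology)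
    moreover have "W \<subseteq> {C \<in> closed_sets pf_down_topology. Gamma_inv C \<in> U}"
      using A(3) Gamma_inv_closed by (force simp: W_def hit_set_pf_minus topspace_hit_topology)
    ultimately show "\<exists>T. openin (hit_topology pf_down_topology) T \<and> C \<in> T \<and>
        T \<subseteq> {C \<in> closed_sets pf_down_topology. Gamma_inv C \<in> U}"
      by blast
  qed
qed (use Gamma_inv_closed in auto)

lemma continuous_map_join_topology:
  assumes "continuous_map X S f" "continuous_map X T f"
  shows "continuous_map X (join_topology S T) f"
  unfolding join_topology_def
proof (rule continuous_on_generated_topo)
  fix U assume "U \<in> {U. openin S U} \<union> {U. openin T U}"
  then have "openin X {x \<in> topspace X. f x \<in> U}"
    using assms openin_continuous_map_preimage by blast
  then show "openin X (f -` U \<inter> topspace X)"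
    by (simp add: vimage_def Int_def conj_commute)
next
  show "f ` topspace X \<subseteq> \<Union>({U. openin S U} \<union> {U. openin T U})"
    using continuous_map_image_subset_topspace[OF assms(1)] openin_topspace by blast
qed

lemma openin_join_topology: "openin S U \<or> openin T U \<Longrightarrow> openin (join_topology S T) U"
  unfolding join_topology_def by (rule topology_generated_by_Basis) blast

text \<open>\<open>filters_topology\<close> refines its open upset and open downset topologies, so
  both earlier continuity results apply to it and combine on the join.\<close>

lemma continuous_map_Gamma_hit_or_miss:
  "continuous_map filters_topology
     (hit_or_miss_topology pf_down_topology :: 'a::{bounded_lattice, distrib_lattice} set set topology) Gamma_map"
  unfolding hit_or_miss_topology_def
proof (rule continuous_map_join_topology)
  show "continuous_map filters_topology (hit_topology pf_down_topology :: 'a set set topology) Gamma_map"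
    using continuous_map_Gamma_hit unfolding continuous_map topspace_open_downset_topology
      openin_open_downset_topology by blast
  show "continuous_map filters_topology (miss_topology pf_down_topology :: 'a set set topology) Gamma_map"
    using continuous_map_Gamma_miss unfolding continuous_map topspace_open_upset_topology
      openin_open_upset_topology by blast
qed

text \<open>Subbasic sets suffice: \<open>filters_up a\<close> and \<open>filters_down a\<close>
  pull back to the miss set and the hit set of \<open>pf_minus a\<close>.\<close>

lemma continuous_map_Gamma_inv_hit_or_miss:
  "continuous_map (hit_or_miss_topology pf_down_topology) filters_topology Gamma_inv"
  unfolding filters_topology_def
proof (rule continuous_map_topology_on_by; unfold topspace_hit_or_miss_topology)
  fix B :: "'a set set" assume "B \<in> range filters_up \<union> range filters_down"
  then consider a where "B = filters_up a" | a where "B = filters_down a"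
    by blast
  then show "openin (hit_or_miss_topology pf_down_topology)
      {C \<in> closed_sets pf_down_topology. Gamma_inv C \<in> B}"
  proof cases
    case 1
    then have "{C \<in> closed_sets pf_down_topology. Gamma_inv C \<in> B} =
        miss_set pf_down_topology (pf_minus a)"
      using Gamma_inv_closed by (auto simp: miss_set_pf_minus filters_up_def)
    then show ?thesis
      unfolding hit_or_miss_topology_def by (simp add: openin_join_topology openin_miss_pf_minus)
  next
    case 2
    then have "{C \<in> closed_sets pf_down_topology. Gamma_inv C \<in> B} =
        hit_set pf_down_topology (pf_minus a)"
      using Gamma_inv_closed by (auto simp: hit_set_pf_minus filters_down_def)
    then show ?thesis
      unfolding hit_or_miss_topology_def by (simp add: openin_join_topology openin_hit_pf_minus)
  qed
qed (use Gamma_inv_closed in auto)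

text \<open>Both \<open>Gamma_map\<close> and its inverse \<open>Gamma_inv\<close> reverse
  inclusions, so the order is also reflected.\<close>

lemma Gamma_map_le_iff:
  fixes F G :: "'a::{bounded_lattice, distrib_lattice} set"
  assumes "F \<in> filters" "G \<in> filters"
  shows "F \<subseteq> G \<longleftrightarrow> Gamma_map G \<subseteq> Gamma_map F"
proof
  assume "Gamma_map G \<subseteq> Gamma_map F"
  then have "Gamma_inv (Gamma_map F) \<subseteq> Gamma_inv (Gamma_map G)"
    unfolding Gamma_inv_def by blast
  then show "F \<subseteq> G"
    using assms by (simp add: Gamma_inv_Gamma_map)
qed (use assms Gamma_map_antimono in blast)

theorem theorem3p7:
  shows "homeomorphic_map (open_upset_topology (filters_topology :: 'a::{bounded_lattice, distrib_lattice} set topology) (\<subseteq>))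
           (miss_topology (pf_down_topology :: 'a set topology)) Gamma_map
       \<and> homeomorphic_map (open_downset_topology filters_topology (\<subseteq>))
           (hit_topology (pf_down_topology :: 'a set topology)) Gamma_map
       \<and> dual_order_homeomorphism filters_topology (\<subseteq>)
           (hit_or_miss_topology (pf_down_topology :: 'a set topology)) (\<subseteq>) Gamma_map
       \<and> spectral_space (miss_topology (pf_down_topology :: 'a set topology))
       \<and> spectral_space (hit_topology (pf_down_topology :: 'a set topology))
       \<and> priestley_space (hit_or_miss_topology (pf_down_topology :: 'a set topology)) (\<subseteq>)"
proof -
  have miss: "homeomorphic_map (open_upset_topology (filters_topology :: 'a set topology) (\<subseteq>))
      (miss_topology pf_down_topology) Gamma_map"
    by (intro homeomorphic_map_Gamma continuous_map_Gamma_miss continuous_map_Gamma_inv_miss)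
      (simp_all add: topspace_miss_topology topspace_open_upset_topology topspace_filters_topology)
  have hit: "homeomorphic_map (open_downset_topology (filters_topology :: 'a set topology) (\<subseteq>))
      (hit_topology pf_down_topology) Gamma_map"
    by (intro homeomorphic_map_Gamma continuous_map_Gamma_hit continuous_map_Gamma_inv_hit)
      (simp_all add: topspace_hit_topology topspace_open_downset_topology topspace_filters_topology)
  have "homeomorphic_map (filters_topology :: 'a set topology)
      (hit_or_miss_topology pf_down_topology) Gamma_map"
    by (intro homeomorphic_map_Gamma continuous_map_Gamma_hit_or_miss
        continuous_map_Gamma_inv_hit_or_miss)
      (simp_all add: topspace_hit_or_miss_topology topspace_filters_topology)
  then have dual: "dual_order_homeomorphism (filters_topology :: 'a set topology) (\<subseteq>)
      (hit_or_miss_topology pf_down_topology) (\<subseteq>) Gamma_map"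
    unfolding dual_order_homeomorphism_def topspace_filters_topology using Gamma_map_le_iff by blast
  \<comment> \<open>Compactness and separation are known for the filter space; the dual
    order-homeomorphism carries them to the hit-or-miss space, and spectrality follows from
    there.\<close>
  have "priestley_space (filters_topology :: 'a set topology) (\<subseteq>)"
    using compact_space_filters_topology unfolding filters_topology_eq
    by (rule priestley_space_family_topology)
  then have P: "priestley_space (hit_or_miss_topology (pf_down_topology :: 'a set topology)) (\<subseteq>)"
    using dual by (rule priestley_space_dual_order_homeomorphism)
  have "spectral_space (miss_topology (pf_down_topology :: 'a set topology))"
    unfolding dual_order_homeomorphism_open_upset[OF dual miss]
    using P by (rule spectral_open_downset_topology)
  moreover have "spectral_space (hit_topology (pf_down_topology :: 'a set topology))"
    unfolding dual_order_homeomorphism_open_downset[OF dual hit]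
    using P by (rule spectral_open_upset_topology)
  ultimately show ?thesis
    using miss hit dual P by blast
qed

end
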